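(* Let $n,m,t,a,r$ be positive integers with $m\ge 2$, $t\ge 3$, $2\le a\le \min\{m,t-1\}$ and $r=mt-a$. Define $$d:=\left\lceil\frac{(m-1)(r-1)n}{mt-2}\right\rceil,\qquad s:=\left\lfloor\frac{d}{m-1}\right\rfloor,\qquad T:=d-(m-1)s,\qquad H:=n+td+(t-2)s-rn,$$ and let $\varepsilon=1$ if $H<0$, or if $H=0$ and $(n-s)\nmid T$; let $\varepsilon=0$ otherwise. If $$(r-1)n-d-\varepsilon\ \ge\ \left\lfloor\frac{3t-4}{3t-1}\,rn\right\rfloor,$$ then $$f(n,r,t+1)=(r-1)n-d-\varepsilon.$$
   Context: A balanced $r$-partite graph with parts of size $n$ is a simple graph whose vertex set is partitioned into $r$ independent sets, each of size $n$. $f(n,r,t+1)$ denotes the largest possible minimum degree of a balanced $r$-partite graph with parts of size $n$ containing no copy of the complete graph $K_{t+1}$. *)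

theory Defs
  imports Complex_Main "HOL-Library.Disjoint_Sets" "HOL-Library.Ramsey"
begin

text \<open>
  A simple graph is given by a vertex set \<open>V\<close> and a set \<open>E\<close> of two-element subsets of \<open>V\<close>.
  The predicates \<open>clique\<close> and \<open>indep\<close> are those of \<open>HOL-Library.Ramsey\<close>.
\<close>

definition simple_graph :: "'a set \<Rightarrow> 'a set set \<Rightarrow> bool" where
  "simple_graph V E \<longleftrightarrow> finite V \<and> E \<subseteq> [V]\<^bsup>2\<^esup>"

definition degree :: "'a set \<Rightarrow> 'a set set \<Rightarrow> 'a \<Rightarrow> nat" where
  "degree V E v = card {u \<in> V. {v, u} \<in> E}"

definition min_degree :: "'a set \<Rightarrow> 'a set set \<Rightarrow> nat" where
  "min_degree V E = Min (degree V E ` V)"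

text \<open>As \<open>partition_on\<close> excludes empty parts, the next definition is only meant for \<open>n > 0\<close>.\<close>

definition balanced_multipartite :: "nat \<Rightarrow> nat \<Rightarrow> 'a set \<Rightarrow> 'a set set \<Rightarrow> bool" where
  "balanced_multipartite n r V E \<longleftrightarrow>
     simple_graph V E \<and>
     (\<exists>P. partition_on V P \<and> card P = r \<and> (\<forall>X\<in>P. card X = n \<and> indep X E))"

definition contains_complete :: "nat \<Rightarrow> 'a set \<Rightarrow> 'a set set \<Rightarrow> bool" where
  "contains_complete k V E \<longleftrightarrow> (\<exists>S \<subseteq> V. card S = k \<and> clique S E)"

text \<open>
  Every finite graph is isomorphic to one whose vertices are natural numbers, so it suffices to
  let \<open>V\<close> range over sets of naturals. For \<open>n, r > 0\<close> and \<open>k \<ge> 2\<close> the set below is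
  finite (degrees are at most \<open>r * n\<close>) and nonempty (take the edgeless graph), so \<open>Max\<close> is the
  actual maximum.
\<close>

definition max_min_degree :: "nat \<Rightarrow> nat \<Rightarrow> nat \<Rightarrow> nat" where
  "max_min_degree n r k =
     Max {min_degree V E | (V :: nat set) E.
            balanced_multipartite n r V E \<and> \<not> contains_complete k V E}"

end

(*
  By the Andrasfai-Erdos-Sos theorem, a graph whose minimum degree exceeds the claimed value is
  t-colourable. It is then described by the matrix of intersection sizes of the r parts with the
  t colour classes W_j, and the degree condition says that |W_j| - x_ij <= D for every positive
  entry, where (r-1)n - D bounds the degrees. Writing y_j = |W_j| - D, one finds y_j <= D div (m-1)
  for all j, while two classes meeting a common part satisfy y_i + y_j <= n. Summing over the
  classes gives H >= 0, and the equality case forces the divisibility. The extremal graphs have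
  t-1 classes that each meet m parts of their own as evenly as possible; the last class takes
  all the rest.
*)
theory Submission
  imports Defs
begin

text \<open>Where \<open>d\<close> comes from: with the floor in \<open>s\<close> dropped,
  \<open>H \<ge> 0\<close> for a deficit \<open>D\<close> reads
  \<open>(mt - 2) D \<ge> (m-1)(r-1) n\<close>, since \<open>(m-1) t + (t-2) = mt - 2\<close>, and
  \<open>d\<close> is the least such integer. The floor may still make \<open>H\<close> negative at
  \<open>d\<close>; at \<open>d + 1\<close> it cannot, so \<epsilon> never exceeds 1. The obstacle
  is that the degree condition bounds only positive entries, so a colour meeting fewer than
  \<open>m\<close> parts might have an excess \<open>y_j\<close> far above \<open>s\<close>. This is
  where \<open>a < t\<close>, that is \<open>r > (m-1) t\<close>, enters: the classes must hold all
  \<open>rn\<close> vertices, and such lean colours cannot carry that many. The same count yields a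
  part meeting two colours, the source of the single \<open>n\<close> in \<open>H\<close>. The
  divisibility originates in a third colour, of total \<open>d + s = ms + T\<close>: when
  \<open>H = 0\<close> its positive entries can only be \<open>s\<close> or \<open>n\<close>, so
  \<open>T\<close> must be made up of steps \<open>n - s\<close>, whereas \<open>H > 0\<close>
  leaves room for entries \<open>s + 1\<close>. The constant \<open>(3t-4)/(3t-1)\<close> is the
  Andrasfai-Erdos-Sos threshold for \<open>t\<close>-colourability of \<open>K_{t+1}\<close>-free
  graphs.\<close>

section \<open>The Andrasfai-Erdos-Sos theorem\<close>

lemma simple_graph_no_loop: "simple_graph V E \<Longrightarrow> {x, x} \<notin> E"
  by (auto simp: simple_graph_def nsets_def)

lemma simple_graph_edge_subset: "simple_graph V E \<Longrightarrow> {x, y} \<in> E \<Longrightarrow> x \<in> V \<and> y \<in> V"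
  by (auto simp: simple_graph_def nsets_def)

lemma simple_graph_edge_neq: "simple_graph V E \<Longrightarrow> {x, y} \<in> E \<Longrightarrow> x \<noteq> y"
  using simple_graph_no_loop by metis

lemma clique_insert:
  "clique (insert x S) E \<longleftrightarrow> clique S E \<and> (\<forall>y\<in>S. x \<noteq> y \<longrightarrow> {x, y} \<in> E)"
  unfolding clique_def by (auto simp: insert_commute)

lemma maximum_clique_missed:
  assumes G: "simple_graph V E" and free: "\<not> contains_complete (Suc c) V E"
    and C: "C \<subseteq> V" "clique C E" "card C = c" and x: "x \<in> V"
  shows "\<exists>y\<in>C. {x, y} \<notin> E"
proof (rule ccontr)
  assume "\<not> ?thesis"
  then have adj: "\<forall>y\<in>C. {x, y} \<in> E" by blast
  then have "x \<notin> C" using simple_graph_no_loop[OF G] by blast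
  moreover have "finite C" using C G finite_subset unfolding simple_graph_def by blast
  ultimately have "card (insert x C) = Suc c" using C by simp
  moreover have "clique (insert x C) E" using C adj by (simp add: clique_insert)
  ultimately show False using free x C unfolding contains_complete_def by blast
qed

text \<open>
  The configuration of Brandt's proof of the Andrasfai-Erdos-Sos theorem: \<open>{w1, w2}\<close> is an edge
  missed by \<open>v\<close>, and the cliques \<open>S\<close> and \<open>Q\<close> witness that neither \<open>{v, w1}\<close> nor \<open>{v, w2}\<close> can
  be added. For \<open>r = 1\<close>, \<open>k = 0\<close> it is a cycle of length 5.
\<close>
definition five_wheel ::
    "'a set \<Rightarrow> 'a set set \<Rightarrow> nat \<Rightarrow> nat \<Rightarrow> 'a \<Rightarrow> 'a \<Rightarrow> 'a \<Rightarrow> 'a set \<Rightarrow> 'a set \<Rightarrow> bool" where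
  "five_wheel V E r k v w1 w2 S Q \<longleftrightarrow>
     {v, w1, w2} \<union> S \<union> Q \<subseteq> V \<and> {w1, w2} \<in> E \<and> {v, w1} \<notin> E \<and> {v, w2} \<notin> E \<and>
     card S = r \<and> card Q = r \<and> card (S \<inter> Q) = k \<and> clique S E \<and> clique Q E \<and>
     (\<forall>x\<in>S. {v, x} \<in> E \<and> {w1, x} \<in> E) \<and> (\<forall>x\<in>Q. {v, x} \<in> E \<and> {w2, x} \<in> E)"

lemma five_wheel_swap:
  "five_wheel V E r k v w1 w2 S Q \<Longrightarrow> five_wheel V E r k v w2 w1 Q S"
  unfolding five_wheel_def by (simp add: insert_commute Int_commute Un_ac)

lemma five_wheel_distinct:
  assumes G: "simple_graph V E" and W: "five_wheel V E r k v w1 w2 S Q"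
  shows "v \<notin> S \<union> Q" "w1 \<notin> S \<union> Q" "w2 \<notin> S \<union> Q" "v \<noteq> w1" "v \<noteq> w2" "w1 \<noteq> w2"
    "finite S" "finite Q"
proof -
  note w = W[unfolded five_wheel_def]
  note loop = simple_graph_no_loop[OF G]
  show "v \<notin> S \<union> Q" "w1 \<notin> S \<union> Q" "w2 \<notin> S \<union> Q" using w loop by blast+
  show "w1 \<noteq> w2" using w loop by blast
  show "v \<noteq> w1" using w by blast
  show "v \<noteq> w2" using w by (auto simp: insert_commute)
  show "finite S" "finite Q"
    using w G finite_subset unfolding simple_graph_def by (metis Un_subset_iff)+
qed

text \<open>\<open>S\<close> with \<open>v\<close>, \<open>S\<close> with \<open>w1\<close>, and
  \<open>Q\<close> with \<open>w2\<close> are cliques of size \<open>r + 1\<close>, and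
  \<open>x\<close> misses a vertex of each. Adjacency to all of \<open>S\<close> places the first
  two misses at \<open>v\<close> and \<open>w1\<close>; the third lies elsewhere.\<close>

lemma five_wheel_nonneighbours_disjoint:
  assumes G: "simple_graph V E" and free: "\<not> contains_complete (r + 2) V E"
    and W: "five_wheel V E r k v w1 w2 S Q" and x: "x \<in> V"
    and dis: "\<forall>y\<in>S. {x, y} \<in> E"
  shows "3 \<le> card {y \<in> {v, w1, w2} \<union> S \<union> Q. {x, y} \<notin> E}" (is "_ \<le> card ?M")
proof -
  note w = W[unfolded five_wheel_def]
  note d = five_wheel_distinct[OF G W]
  have free': "\<not> contains_complete (Suc (Suc r)) V E" using free by simp
  have miss: "\<exists>y\<in>insert z C. {x, y} \<notin> E"
    if "z \<in> V" "C \<subseteq> V" "clique C E" "card C = r" "\<forall>y\<in>C. {z, y} \<in> E" "z \<notin> C" "finite C" for z C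
    by (rule maximum_clique_missed[OF G free']) (use that x in \<open>auto simp: clique_insert\<close>)
  have 1: "{x, v} \<notin> E" using miss[of v S] w d dis by auto
  have 2: "{x, w1} \<notin> E" using miss[of w1 S] w d dis by auto
  obtain y where y: "y \<in> insert w2 Q" "{x, y} \<notin> E" using miss[of w2 Q] w d by auto
  have "y \<noteq> v" "y \<noteq> w1" using y d by auto
  then have "3 = card {v, w1, y}" using d by simp
  also have "\<dots> \<le> card ?M" by (rule card_mono) (use 1 2 y d in auto)
  finally show ?thesis .
qed

text \<open>By the previous lemma and its mirror image, fewer than three misses means one in
  \<open>S\<close>, one in \<open>Q\<close> and no other. Both lie outside the core, and exchanging
  them for \<open>x\<close> contradicts the maximality of \<open>k\<close>.\<close>

lemma five_wheel_nonneighbours: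
  assumes G: "simple_graph V E" and free: "\<not> contains_complete (r + 2) V E"
    and W: "five_wheel V E r k v w1 w2 S Q"
    and max: "\<And>S' Q'. \<not> five_wheel V E r (Suc k) v w1 w2 S' Q'"
    and x: "x \<in> V" and core: "\<forall>y\<in>S \<inter> Q. {x, y} \<in> E"
  shows "3 \<le> card {y \<in> {v, w1, w2} \<union> S \<union> Q. {x, y} \<notin> E}" (is "_ \<le> card ?M")
proof (rule ccontr)
  assume few: "\<not> ?thesis"
  note w = W[unfolded five_wheel_def]
  note d = five_wheel_distinct[OF G W]
  obtain p where p: "p \<in> S" "{x, p} \<notin> E"
    using five_wheel_nonneighbours_disjoint[OF G free W x] few by blast
  have "{y \<in> {v, w2, w1} \<union> Q \<union> S. {x, y} \<notin> E} = ?M" by auto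
  then obtain q where q: "q \<in> Q" "{x, q} \<notin> E"
    using five_wheel_nonneighbours_disjoint[OF G free five_wheel_swap[OF W] x] few by metis
  have pq: "p \<notin> Q" "q \<notin> S" "p \<noteq> q" using p q core by auto
  have "?M = {p, q}"
  proof (rule sym, rule card_subset_eq)
    show "finite ?M" using d by auto
    show sub: "{p, q} \<subseteq> ?M" using p q by auto
    show "card {p, q} = card ?M"
      using few pq card_mono[OF \<open>finite ?M\<close> sub] by simp
  qed
  then have adj: "{x, y} \<in> E" if "y \<in> {v, w1, w2} \<union> S \<union> Q" "y \<noteq> p" "y \<noteq> q" for y
    using that by blast
  have loop: "\<And>z. {z, z} \<notin> E" using simple_graph_no_loop[OF G] .
  have n: "v \<noteq> p" "v \<noteq> q" "w1 \<noteq> p" "w2 \<noteq> p" "w1 \<noteq> q" "w2 \<noteq> q"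
    using d p q by blast+
  have xS: "x \<notin> S - {p}" "x \<notin> Q - {q}" using adj loop pq by blast+
  \<comment> \<open>Replacing \<open>p\<close> and \<open>q\<close> by the common neighbour \<open>x\<close> would enlarge the core.\<close>
  have "five_wheel V E r (Suc k) v w1 w2 (insert x (S - {p})) (insert x (Q - {q}))"
    unfolding five_wheel_def
  proof (intro conjI)
    show "{v, w1, w2} \<union> insert x (S - {p}) \<union> insert x (Q - {q}) \<subseteq> V" using w x by auto
    show "card (insert x (S - {p})) = r" "card (insert x (Q - {q})) = r"
      using xS d p q w by (metis card.insert card_Suc_Diff1 finite_Diff)+
    have "insert x (S - {p}) \<inter> insert x (Q - {q}) = insert x (S \<inter> Q)" using pq by auto
    moreover have "x \<notin> S \<inter> Q" using core loop by blast
    ultimately show "card (insert x (S - {p}) \<inter> insert x (Q - {q})) = Suc k"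
      using w d by simp
    have "clique (S - {p}) E" "clique (Q - {q}) E" using w unfolding clique_def by blast+
    then show "clique (insert x (S - {p})) E" "clique (insert x (Q - {q})) E"
      using adj pq by (auto simp: clique_insert)
    have "{v, x} \<in> E" "{w1, x} \<in> E" "{w2, x} \<in> E"
      using adj[of v] adj[of w1] adj[of w2] n by (auto simp: insert_commute)
    then show "\<forall>y\<in>insert x (S - {p}). {v, y} \<in> E \<and> {w1, y} \<in> E"
      "\<forall>y\<in>insert x (Q - {q}). {v, y} \<in> E \<and> {w2, y} \<in> E" using w by auto
  qed (use w in auto)
  then show False using max by blast
qed

text \<open>Weighted double counting of the edges between the wheel and \<open>V\<close>. The wheel
  has \<open>2r + 3 - k\<close> vertices, and weight 3 on the \<open>k\<close> core vertices raises
  the total to \<open>2r + k + 3\<close>. That weight makes a single missed core vertex cost as much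
  as three missed ordinary ones.\<close>

lemma five_wheel_min_degree:
  fixes \<delta> :: nat
  assumes G: "simple_graph V E" and free: "\<not> contains_complete (r + 2) V E"
    and W: "five_wheel V E r k v w1 w2 S Q"
    and max: "\<And>S' Q'. \<not> five_wheel V E r (Suc k) v w1 w2 S' Q'"
    and deg: "\<And>u. u \<in> V \<Longrightarrow> \<delta> \<le> degree V E u"
  shows "(2 * r + k + 3) * \<delta> \<le> (2 * r + k) * card V"
proof -
  have fin: "finite V" using G by (simp add: simple_graph_def)
  note w = W[unfolded five_wheel_def]
  note d = five_wheel_distinct[OF G W]
  define U where "U = {v, w1, w2} \<union> S \<union> Q"
  \<comment> \<open>With weight 3 on the core, every vertex of \<open>V\<close> misses weight at least 3 of the wheel.\<close>
  define f where "f = (\<lambda>y. if y \<in> S \<inter> Q then 3 else (1::nat))"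
  have finU: "finite U" and UV: "U \<subseteq> V" unfolding U_def using d w by auto
  have "card U = 3 + card (S \<union> Q)" unfolding U_def using d by simp
  moreover have "card (S \<union> Q) + k = 2 * r" using card_Un_Int[OF d(7,8)] w by simp
  ultimately have cU: "card U + k = 2 * r + 3" by simp
  have "sum f U = (\<Sum>y\<in>U. 1 + (if y \<in> S \<inter> Q then 2 else 0))"
    by (rule sum.cong) (auto simp: f_def)
  also have "\<dots> = card U + 2 * card (S \<inter> Q)"
  proof -
    have "U \<inter> (S \<inter> Q) = S \<inter> Q" unfolding U_def by auto
    then show ?thesis using finU by (simp only: sum.distrib) (simp add: sum.If_cases Collect_conj_eq flip: Int_def)
  qed
  finally have fU: "sum f U = 2 * r + k + 3" using w cU by simp
  have missed: "3 \<le> sum f {y \<in> U. {x, y} \<notin> E}" if x: "x \<in> V" for x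
  proof (cases "\<forall>y\<in>S \<inter> Q. {x, y} \<in> E")
    case True
    have "card {y \<in> U. {x, y} \<notin> E} \<le> sum f {y \<in> U. {x, y} \<notin> E}"
      unfolding card_eq_sum by (rule sum_mono) (auto simp: f_def)
    with five_wheel_nonneighbours[OF G free W max x True] show ?thesis
      unfolding U_def by simp
  next
    case False
    then obtain y where y: "y \<in> S \<inter> Q" "{x, y} \<notin> E" by blast
    then have "y \<in> {y \<in> U. {x, y} \<notin> E}" unfolding U_def by blast
    then have "f y \<le> sum f {y \<in> U. {x, y} \<notin> E}"
      by (rule member_le_sum) (use finU in auto)
    then show ?thesis using y by (simp add: f_def)
  qed
  have hit: "sum f {y \<in> U. {x, y} \<in> E} \<le> 2 * r + k" if x: "x \<in> V" for x
  proof -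
    have "sum f U = sum f ({y \<in> U. {x, y} \<in> E} \<union> {y \<in> U. {x, y} \<notin> E})"
      by (rule sum.cong) auto
    also have "\<dots> = sum f {y \<in> U. {x, y} \<in> E} + sum f {y \<in> U. {x, y} \<notin> E}"
      by (rule sum.union_disjoint) (use finU in auto)
    finally show ?thesis using missed[OF x] fU by linarith
  qed
  have "(2 * r + k + 3) * \<delta> = (\<Sum>y\<in>U. f y * \<delta>)" by (simp only: fU[symmetric] sum_distrib_right)
  also have "\<dots> \<le> (\<Sum>y\<in>U. f y * degree V E y)"
    using deg UV by (intro sum_mono mult_le_mono2) auto
  also have "\<dots> = (\<Sum>y\<in>U. \<Sum>x\<in>V. if {x, y} \<in> E then f y else 0)"
  proof (rule sum.cong)
    fix y
    have "degree V E y = card (V \<inter> {x. {x, y} \<in> E})"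
      unfolding degree_def by (rule arg_cong[where f = card]) (auto simp: insert_commute)
    then show "f y * degree V E y = (\<Sum>x\<in>V. if {x, y} \<in> E then f y else 0)"
      using fin by (simp add: sum.If_cases)
  qed simp
  also have "\<dots> = (\<Sum>x\<in>V. \<Sum>y\<in>U. if {x, y} \<in> E then f y else 0)" by (rule sum.swap)
  also have "\<dots> = (\<Sum>x\<in>V. sum f {y \<in> U. {x, y} \<in> E})"
    using finU by (simp add: sum.inter_filter)
  also have "\<dots> \<le> (\<Sum>x\<in>V. 2 * r + k)" by (rule sum_mono) (rule hit)
  finally show ?thesis by (simp add: mult.commute)
qed

section \<open>Edge-maximal graphs as complete multipartite graphs\<close>

lemma edge_maximal_nonadjacent:
  assumes G: "simple_graph V E" and free: "\<not> contains_complete (r + 2) V E"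
    and max: "\<And>F. E \<subset> F \<Longrightarrow> simple_graph V F \<Longrightarrow> contains_complete (r + 2) V F"
    and uv: "u \<in> V" "v \<in> V" "u \<noteq> v" "{u, v} \<notin> E"
  obtains S where "S \<subseteq> V" "card S = r" "clique S E" "\<forall>x\<in>S. {u, x} \<in> E \<and> {v, x} \<in> E"
proof -
  have "simple_graph V (insert {u, v} E)"
    using G uv by (auto simp: simple_graph_def nsets_def)
  then obtain K where K: "K \<subseteq> V" "card K = r + 2" "clique K (insert {u, v} E)"
    using max[of "insert {u, v} E"] uv unfolding contains_complete_def by blast
  have uvK: "u \<in> K \<and> v \<in> K"
  proof (rule ccontr)
    assume "\<not> ?thesis"
    then have "clique K E" using K(3) unfolding clique_def by (auto simp: doubleton_eq_iff)
    then show False using free K unfolding contains_complete_def by blast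
  qed
  have finK: "finite K" using K G finite_subset unfolding simple_graph_def by blast
  show thesis
  proof
    show "K - {u, v} \<subseteq> V" using K by blast
    show "card (K - {u, v}) = r" using K uvK uv finK by (simp add: card_Diff_subset)
    show "clique (K - {u, v}) E" using K(3) unfolding clique_def by (auto simp: doubleton_eq_iff)
    show "\<forall>x\<in>K - {u, v}. {u, x} \<in> E \<and> {v, x} \<in> E"
      using K(3) uvK unfolding clique_def by (auto simp: doubleton_eq_iff)
  qed
qed

lemma edge_maximal_extension:
  assumes "simple_graph V E" "\<not> contains_complete k V E"
  obtains F where "E \<subseteq> F" "simple_graph V F" "\<not> contains_complete k V F"
    "\<And>F'. F \<subset> F' \<Longrightarrow> simple_graph V F' \<Longrightarrow> contains_complete k V F'"
proof -
  let ?A = "{F. simple_graph V F \<and> \<not> contains_complete k V F}"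
  have "?A \<subseteq> Pow (Pow V)" unfolding simple_graph_def nsets_def by blast
  moreover have "finite V" using assms by (simp add: simple_graph_def)
  ultimately have "finite ?A" by (meson finite_Pow_iff finite_subset)
  then obtain F where "F \<in> ?A" "E \<subseteq> F" "\<forall>F'\<in>?A. F \<subseteq> F' \<longrightarrow> F = F'"
    using finite_has_maximal2[of ?A E] assms by blast
  then show thesis using that[of F] by blast
qed

text \<open>Nonadjacency turns out to be an equivalence relation, and its classes are the colours:
  one vertex from each class forms a clique, so there are at most \<open>r + 1\<close> of them. A
  failure of transitivity would produce a five-wheel, and one with the largest core contradicts the
  degree condition.\<close>

lemma edge_maximal_colourable:
  assumes G: "simple_graph V E" and free: "\<not> contains_complete (r + 2) V E"
    and max: "\<And>F. E \<subset> F \<Longrightarrow> simple_graph V F \<Longrightarrow> contains_complete (r + 2) V F"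
    and deg: "\<And>u. u \<in> V \<Longrightarrow> (3 * int r - 1) * int (card V) < (3 * int r + 2) * int (degree V E u)"
  shows "\<exists>c. (\<forall>u\<in>V. c u < r + 1) \<and> (\<forall>u v. {u, v} \<in> E \<longrightarrow> c u \<noteq> c v)"
proof -
  have fin: "finite V" using G by (simp add: simple_graph_def)
  define R where "R = {(u, v). u \<in> V \<and> v \<in> V \<and> {u, v} \<notin> E}"
  have trans: "{w1, w2} \<notin> E" if vw: "v \<in> V" "w1 \<in> V" "w2 \<in> V" "{v, w1} \<notin> E" "{v, w2} \<notin> E" for v w1 w2
  proof
    assume e: "{w1, w2} \<in> E"
    have n: "v \<noteq> w1" "v \<noteq> w2" using vw e by (auto simp: insert_commute)
    obtain S where S: "S \<subseteq> V" "card S = r" "clique S E" "\<forall>x\<in>S. {v, x} \<in> E \<and> {w1, x} \<in> E"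
      using edge_maximal_nonadjacent[OF G free max] vw n by metis
    obtain Q where Q: "Q \<subseteq> V" "card Q = r" "clique Q E" "\<forall>x\<in>Q. {v, x} \<in> E \<and> {w2, x} \<in> E"
      using edge_maximal_nonadjacent[OF G free max] vw n by metis
    let ?P = "\<lambda>k. \<exists>S Q. five_wheel V E r k v w1 w2 S Q"
    \<comment> \<open>A full core would give \<open>S = Q\<close>, and \<open>S\<close> with the
      edge \<open>{w1, w2}\<close> would be a clique of size \<open>r + 2\<close>.\<close>
    have less: "k < r" if "?P k" for k
    proof -
      from that obtain S Q where W: "five_wheel V E r k v w1 w2 S Q" by blast
      note w = W[unfolded five_wheel_def]
      note finS = five_wheel_distinct(7,8)[OF G W]
      have "k \<noteq> r"
      proof
        assume "k = r"
        then have "S \<inter> Q = S" "S \<inter> Q = Q" using w finS by (metis card_subset_eq Int_lower1 Int_lower2)+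
        then have SQ: "S = Q" by simp
        have "w1 \<notin> S" using w simple_graph_no_loop[OF G] by blast
        moreover have "clique (insert w1 S) E" using w by (simp add: clique_insert)
        ultimately obtain y where "y \<in> insert w1 S" "{w2, y} \<notin> E"
          using maximum_clique_missed[OF G, of "Suc r" "insert w1 S" w2] free w finS by auto
        then show False using w SQ by (auto simp: insert_commute)
      qed
      moreover have "k \<le> r" using w finS by (metis card_mono Int_lower1)
      ultimately show ?thesis by simp
    qed
    have "?P (card (S \<inter> Q))" using S Q vw e unfolding five_wheel_def by blast
    then have ex: "?P (Greatest ?P)" and great: "\<And>k. ?P k \<Longrightarrow> k \<le> Greatest ?P"
      using GreatestI_nat[of ?P _ r] Greatest_le_nat[of ?P _ r] less by (meson less_imp_le)+
    define k where "k = Greatest ?P"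
    obtain S' Q' where W: "five_wheel V E r k v w1 w2 S' Q'" using ex unfolding k_def by blast
    have nW: "\<not> five_wheel V E r (Suc k) v w1 w2 S'' Q''" for S'' Q''
      using great[of "Suc k"] unfolding k_def by auto
    define \<delta> where "\<delta> = Min (degree V E ` V)"
    have "\<delta> \<in> degree V E ` V" unfolding \<delta>_def using fin vw by (intro Min_in) auto
    then obtain u where u: "u \<in> V" "\<delta> = degree V E u" by blast
    have "degree V E u \<le> card V" unfolding degree_def using fin by (intro card_mono) auto
    then have 1: "int \<delta> \<le> int (card V)" using u by simp
    have "(2 * r + k + 3) * \<delta> \<le> (2 * r + k) * card V"
      by (rule five_wheel_min_degree[OF G free W nW]) (simp add: \<delta>_def fin)
    then have 2: "(2 * int r + int k + 3) * int \<delta> \<le> (2 * int r + int k) * int (card V)"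
      by (metis (mono_tags, opaque_lifting) of_nat_add of_nat_mult of_nat_numeral of_nat_le_iff)
    have "k < r" using less ex unfolding k_def by blast
    \<comment> \<open>The ratio \<open>(2r + k) / (2r + k + 3)\<close> increases with
      \<open>k\<close>; at its largest value \<open>k = r - 1\<close> it equals
      \<open>(3r - 1) / (3r + 2)\<close>.\<close>
    then have "0 \<le> (int r - 1 - int k) * (int (card V) - int \<delta>)" using 1 by simp
    with 2 have "(3 * int r + 2) * int \<delta> \<le> (3 * int r - 1) * int (card V)" by (simp add: algebra_simps)
    then show False using deg[OF u(1)] u(2) by simp
  qed
  have eq: "equiv V R"
  proof (rule equivI)
    show "R \<subseteq> V \<times> V" unfolding R_def by auto
    show "refl_on V R" unfolding R_def refl_on_def using simple_graph_no_loop[OF G] by auto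
    show "sym R" unfolding R_def sym_def by (auto simp: insert_commute)
    show "trans R"
    proof (rule transI)
      fix x y z assume "(x, y) \<in> R" "(y, z) \<in> R"
      then show "(x, z) \<in> R"
        unfolding R_def using trans[of y x z] by (auto simp: insert_commute)
    qed
  qed
  define B where "B = V // R"
  have finB: "finite B" unfolding B_def using fin eq by (simp add: finite_quotient equiv_type)
  have "card B \<le> r + 1"
  proof (rule ccontr)
    assume "\<not> ?thesis"
    then obtain B' where B': "B' \<subseteq> B" "card B' = r + 2"
      using obtain_subset_with_card_n[of "r + 2" B] by auto
    define g where "g X = (SOME x. x \<in> X)" for X :: "'a set"
    have g: "g X \<in> X" if "X \<in> B" for X
      using that eq unfolding B_def g_def by (metis in_quotient_imp_non_empty some_in_eq)
    have gV: "g X \<in> V" if "X \<in> B" for X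
      using g[OF that] that eq unfolding B_def by (metis in_quotient_imp_subset subsetD)
    have adj: "{g X, g Y} \<in> E" if "X \<in> B" "Y \<in> B" "X \<noteq> Y" for X Y
    proof (rule ccontr)
      assume "{g X, g Y} \<notin> E"
      then have "(g X, g Y) \<in> R" unfolding R_def using gV that by blast
      then have "X = Y" using quotient_eqI[OF eq, of X Y "g X" "g Y"] that g unfolding B_def by blast
      then show False using that by blast
    qed
    then have "inj_on g B'"
      using B' simple_graph_no_loop[OF G] unfolding inj_on_def by (metis subsetD)
    then have "card (g ` B') = r + 2" using B' by (simp add: card_image)
    moreover have "clique (g ` B') E" unfolding clique_def using adj B' by blast
    moreover have "g ` B' \<subseteq> V" using gV B' by blast
    ultimately show False using free unfolding contains_complete_def by blast
  qed
  moreover obtain h where h: "bij_betw h B {0..<card B}" using ex_bij_betw_finite_nat[OF finB] by blast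
  moreover have cls: "R `` {u} \<in> B" if "u \<in> V" for u unfolding B_def using that by (rule quotientI)
  ultimately have "\<forall>u\<in>V. h (R `` {u}) < r + 1" using bij_betwE by fastforce
  moreover have "h (R `` {u}) \<noteq> h (R `` {v})" if "{u, v} \<in> E" for u v
  proof
    have uv: "u \<in> V" "v \<in> V" using simple_graph_edge_subset[OF G that] by auto
    assume "h (R `` {u}) = h (R `` {v})"
    then have "R `` {u} = R `` {v}" using h cls uv unfolding bij_betw_def inj_on_def by blast
    then have "(u, v) \<in> R" using eq uv by (simp add: eq_equiv_class_iff)
    then show False using that unfolding R_def by blast
  qed
  ultimately show ?thesis by (intro exI[of _ "\<lambda>u. h (R `` {u})"]) blast
qed

text \<open>Adding edges on the same vertex set only raises degrees, and a proper colouring of the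
  larger graph is one of \<open>E\<close>. The bound is over the integers because
  \<open>3r - 1\<close> is negative at \<open>r = 0\<close>.\<close>

theorem andrasfai_erdos_sos:
  assumes G: "simple_graph V E" and free: "\<not> contains_complete (r + 2) V E"
    and deg: "\<And>u. u \<in> V \<Longrightarrow> (3 * int r - 1) * int (card V) < (3 * int r + 2) * int (degree V E u)"
  shows "\<exists>c. (\<forall>u\<in>V. c u < r + 1) \<and> (\<forall>u v. {u, v} \<in> E \<longrightarrow> c u \<noteq> c v)"
proof -
  obtain F where F: "E \<subseteq> F" "simple_graph V F" "\<not> contains_complete (r + 2) V F"
    "\<And>F'. F \<subset> F' \<Longrightarrow> simple_graph V F' \<Longrightarrow> contains_complete (r + 2) V F'"
    using edge_maximal_extension[OF G free] by metis
  have "degree V E u \<le> degree V F u" for u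
    unfolding degree_def using F(1,2) by (intro card_mono) (auto simp: simple_graph_def)
  then have "(3 * int r + 2) * int (degree V E u) \<le> (3 * int r + 2) * int (degree V F u)" for u
    by (simp add: mult_left_mono)
  then have "\<exists>c. (\<forall>u\<in>V. c u < r + 1) \<and> (\<forall>u v. {u, v} \<in> F \<longrightarrow> c u \<noteq> c v)"
    by (intro edge_maximal_colourable[OF F(2,3,4)] less_le_trans[OF deg])
  then show ?thesis using F(1) by blast
qed

section \<open>Matrices of intersection sizes\<close>

text \<open>
  Here \<open>x X j\<close> stands for the number of vertices of colour \<open>j\<close> in the part \<open>X\<close>, and \<open>M\<close> for
  \<open>m - 1\<close>.
\<close>
locale sparse_column_matrix =
  fixes P :: "'p set" and x :: "'p \<Rightarrow> nat \<Rightarrow> int" and t :: nat and n M D :: int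
  assumes finP: "finite P" and nonneg: "\<And>X j. 0 \<le> x X j"
    and row: "\<And>X. X \<in> P \<Longrightarrow> (\<Sum>j<t. x X j) = n"
    and n_pos: "0 < n" and M_pos: "0 < M" and D_nonneg: "0 \<le> D" and D_less: "D < M * n"
    and deficit: "\<And>X j. X \<in> P \<Longrightarrow> j < t \<Longrightarrow> 0 < x X j \<Longrightarrow> (\<Sum>Y\<in>P. x Y j) - x X j \<le> D"
    and many_rows: "M * int t < int (card P)"
begin

definition w where "w j = (\<Sum>X\<in>P. x X j)"
definition y where "y j = w j - D"
definition k where "k j = int (card {X \<in> P. 0 < x X j})"
definition s where "s = D div M"

section \<open>Column totals and column excesses\<close>

lemma entry_le: "X \<in> P \<Longrightarrow> j < t \<Longrightarrow> x X j \<le> n"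
  using row[of X] member_le_sum[of j "{..<t}" "x X"] nonneg by auto

lemma entry_ge: "X \<in> P \<Longrightarrow> j < t \<Longrightarrow> 0 < x X j \<Longrightarrow> y j \<le> x X j"
  using deficit[of X j] unfolding y_def w_def by simp

lemma w_support: "w j = (\<Sum>X\<in>{X \<in> P. 0 < x X j}. x X j)"
  unfolding w_def using finP nonneg
  by (intro sum.mono_neutral_right) (auto simp: less_le)

lemma w_le: "j < t \<Longrightarrow> w j \<le> k j * n"
  using sum_bounded_above[of "{X \<in> P. 0 < x X j}" "\<lambda>X. x X j" n] entry_le
  unfolding w_support k_def by auto

lemma w_ge: "j < t \<Longrightarrow> k j * y j \<le> w j"
  using sum_bounded_below[of "{X \<in> P. 0 < x X j}" "y j" "\<lambda>X. x X j"] entry_ge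
  unfolding w_support[of j] k_def by auto

lemma s_bounds: "0 \<le> s" "M * s \<le> D" "D < M * (s + 1)"
proof -
  show "0 \<le> s" unfolding s_def using M_pos D_nonneg by (simp add: pos_imp_zdiv_nonneg_iff)
  have "M * s + D mod M = D" unfolding s_def by simp
  moreover have "0 \<le> D mod M" "D mod M < M" using M_pos by auto
  ultimately show "M * s \<le> D" "D < M * (s + 1)" by (auto simp: algebra_simps)
qed

lemma s_less: "s < n"
proof -
  have "M * s < M * n" using s_bounds D_less by simp
  then show ?thesis using M_pos by simp
qed

text \<open>With more than \<open>M\<close> positive entries, each at least \<open>y j\<close>, the
  column would satisfy \<open>M * y j \<le> D\<close> and hence \<open>y j \<le> s\<close>. So an
  excess above \<open>s\<close> confines the column to \<open>M\<close> rows, which hold at most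
  \<open>M * n\<close>.\<close>

lemma large_excess: assumes "j < t" "s < y j" shows "y j \<le> M * n - D"
proof -
  have "k j \<le> M"
  proof (rule ccontr)
    assume "\<not> ?thesis"
    then have "(M + 1) * y j \<le> k j * y j" using assms s_bounds by (intro mult_right_mono) auto
    then have "M * y j \<le> D" using w_ge[OF assms(1)] by (simp add: y_def algebra_simps)
    moreover have "M * (s + 1) \<le> M * y j" using assms M_pos by simp
    ultimately show False using s_bounds by simp
  qed
  then have "k j * n \<le> M * n" using n_pos by simp
  then show ?thesis using w_le[OF assms(1)] by (simp add: y_def)
qed

lemma sum_w: "(\<Sum>j<t. w j) = int (card P) * n"
proof -
  have "(\<Sum>j<t. w j) = (\<Sum>X\<in>P. \<Sum>j<t. x X j)" unfolding w_def by (rule sum.swap)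
  then show ?thesis using row by simp
qed

lemma sum_y: "(\<Sum>j<t. y j) = int (card P) * n - int t * D"
  unfolding y_def by (simp add: sum_subtractf sum_w)

lemma rows_ge: "int t * (M * n) + n \<le> int (card P) * n"
proof -
  have "(M * int t + 1) * n \<le> int (card P) * n" using many_rows n_pos by simp
  then show ?thesis by (simp add: algebra_simps)
qed

text \<open>Otherwise large and small excesses alike are at most \<open>M * n - D\<close>, so every
  column total is at most \<open>M * n\<close>, too little for more than \<open>M * t\<close> rows
  of sum \<open>n\<close>. The bound makes the large case above yield \<open>y j \<le> s\<close> as
  well.\<close>

lemma D_plus_s: "M * n \<le> D + s"
proof (rule ccontr)
  assume "\<not> ?thesis"
  then have "y j \<le> M * n - D" if "j < t" for j
    using large_excess[OF that] by (cases "s < y j") auto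
  then have "(\<Sum>j<t. y j) \<le> int t * (M * n - D)"
    using sum_bounded_above[of "{..<t}" y] by auto
  then show False using rows_ge n_pos unfolding sum_y right_diff_distrib by linarith
qed

lemma excess_le: "j < t \<Longrightarrow> y j \<le> s"
  using large_excess[of j] D_plus_s by linarith

section \<open>Rows shared by two columns\<close>

lemma shared_row:
  assumes "X \<in> P" "i < t" "j < t" "i \<noteq> j" "0 < x X i" "0 < x X j"
  shows "y i \<le> x X i" "y j \<le> x X j" "x X i + x X j \<le> n"
proof -
  show "y i \<le> x X i" "y j \<le> x X j" using assms entry_ge by auto
  have "(\<Sum>l\<in>{i, j}. x X l) \<le> (\<Sum>l<t. x X l)"
    using assms nonneg by (intro sum_mono2) auto
  then show "x X i + x X j \<le> n" using assms row[of X] by simp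
qed

lemma unshared_entry:
  assumes "X \<in> P" "j < t" "0 < x X j" "\<And>i. i < t \<Longrightarrow> i \<noteq> j \<Longrightarrow> \<not> 0 < x X i"
  shows "x X j = n"
proof -
  have "(\<Sum>i<t. x X i) = x X j + (\<Sum>i\<in>{..<t} - {j}. x X i)"
    using assms by (simp add: sum.remove)
  also have "(\<Sum>i\<in>{..<t} - {j}. x X i) = 0"
    using assms nonneg by (intro sum.neutral) (auto simp: less_le)
  finally show ?thesis using row assms by simp
qed

text \<open>If no row is shared, every entry is 0 or \<open>n\<close>. As there are more than
  \<open>M * t\<close> rows, some column has at least \<open>M + 1\<close> entries \<open>n\<close>;
  removing one of them leaves at least \<open>M * n > D\<close>, against the deficit
  condition.\<close>

lemma shared_row_exists:
  obtains X i j where "X \<in> P" "i < t" "j < t" "i \<noteq> j" "0 < x X i" "0 < x X j"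
proof (rule ccontr)
  assume "\<not> thesis"
  then have no: "\<And>X i j. X \<in> P \<Longrightarrow> i < t \<Longrightarrow> j < t \<Longrightarrow> i \<noteq> j \<Longrightarrow> 0 < x X i \<Longrightarrow> 0 < x X j \<Longrightarrow> False"
    using that by blast
  have whole: "x X j = n" if "X \<in> P" "j < t" "0 < x X j" for X j
    using unshared_entry no that by blast
  have "\<exists>j<t. M * n < w j"
  proof (rule ccontr)
    assume "\<not> ?thesis"
    then have "(\<Sum>j<t. w j) \<le> int t * (M * n)"
      using sum_bounded_above[of "{..<t}" w "M * n"] by force
    then show False using rows_ge n_pos unfolding sum_w by linarith
  qed
  then obtain j where j: "j < t" "M * n < w j" by blast
  have "w j = (\<Sum>X\<in>{X \<in> P. 0 < x X j}. n)"
    unfolding w_support using whole j by (intro sum.cong) auto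
  then have wk: "w j = k j * n" by (simp add: k_def)
  then have kj: "M < k j" using j n_pos by simp
  then have "card {X \<in> P. 0 < x X j} \<noteq> 0" using M_pos unfolding k_def by linarith
  then have "{X \<in> P. 0 < x X j} \<noteq> {}" by (metis card.empty)
  then obtain X where X: "X \<in> P" "0 < x X j" by blast
  then have "k j * n - n \<le> D" using deficit[of X j] whole j wk unfolding w_def by simp
  moreover have "(M + 1) * n \<le> k j * n" using kj n_pos by simp
  ultimately show False using D_less by (simp add: algebra_simps)
qed

lemma sum_y_pair:
  assumes "i < t" "j < t" "i \<noteq> j"
  shows "(\<Sum>l<t. y l) = y i + y j + (\<Sum>l\<in>{..<t} - {i, j}. y l)"
    and "int (card ({..<t} - {i, j})) = int t - 2"
proof -
  have "(\<Sum>l<t. y l) = (\<Sum>l\<in>{i, j}. y l) + (\<Sum>l\<in>{..<t} - {i, j}. y l)"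
    using assms by (subst sum.subset_diff[of "{i, j}"]) auto
  then show "(\<Sum>l<t. y l) = y i + y j + (\<Sum>l\<in>{..<t} - {i, j}. y l)" using assms by simp
  show "int (card ({..<t} - {i, j})) = int t - 2" using assms by (simp add: card_Diff_subset)
qed

lemma sum_y_pair_le:
  assumes "i < t" "j < t" "i \<noteq> j"
  shows "(\<Sum>l<t. y l) \<le> y i + y j + (int t - 2) * s"
proof -
  have "(\<Sum>l\<in>{..<t} - {i, j}. y l) \<le> int (card ({..<t} - {i, j})) * s"
    using excess_le by (intro sum_bounded_above) auto
  then show ?thesis using sum_y_pair[OF assms] by simp
qed

section \<open>The slack and its equality case\<close>

lemma slack_nonneg: "0 \<le> n + int t * D + (int t - 2) * s - int (card P) * n"
proof -
  obtain X i j where X: "X \<in> P" "i < t" "j < t" "i \<noteq> j" "0 < x X i" "0 < x X j"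
    by (rule shared_row_exists)
  show ?thesis using shared_row[OF X] sum_y_pair_le[OF X(2-4)] sum_y by linarith
qed

text \<open>The column \<open>c\<close> has total \<open>D + s = (M + 1) * s + D mod M\<close> and
  positive entries \<open>s\<close> or \<open>n\<close> only. Once it is known to have exactly
  \<open>M + 1\<close> positive entries, comparing totals shows that \<open>D mod M\<close> is a
  multiple of \<open>n - s\<close>.\<close>

lemma slack_zero_dvd:
  assumes slack: "n + int t * D + (int t - 2) * s - int (card P) * n = 0" and t3: "3 \<le> t"
  shows "(n - s) dvd D mod M"
proof -
  have sum: "(\<Sum>l<t. y l) = n + (int t - 2) * s" using slack sum_y by simp
  \<comment> \<open>All columns outside the pair \<open>i, j\<close> have excess \<open>s\<close>; \<open>t \<ge> 3\<close> provides such a column \<open>c\<close>.\<close>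
  obtain X0 i j where X0: "X0 \<in> P" "i < t" "j < t" "i \<noteq> j" "0 < x X0 i" "0 < x X0 j"
    by (rule shared_row_exists)
  have "y i + y j \<le> n" using shared_row[OF X0] by simp
  then have rest: "(int t - 2) * s \<le> (\<Sum>l\<in>{..<t} - {i, j}. y l)"
    using sum sum_y_pair[OF X0(2-4)] by simp
  have "n \<le> 2 * s" using sum sum_y_pair_le[OF X0(2-4)] excess_le[of i] excess_le[of j] X0 by simp
  then have s_pos: "0 < s" using n_pos by simp
  have "\<not> {..<t} \<subseteq> {i, j}"
  proof
    assume "{..<t} \<subseteq> {i, j}"
    then have "card {..<t} \<le> card {i, j}" by (intro card_mono) auto
    then show False using t3 X0 by simp
  qed
  then obtain c where c: "c < t" "c \<noteq> i" "c \<noteq> j" by auto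
  have yc: "y c = s"
  proof -
    have "(\<Sum>l\<in>{..<t} - {i, j}. y l) = y c + (\<Sum>l\<in>{..<t} - {i, j} - {c}. y l)"
      using c by (simp add: sum.remove)
    moreover have "(\<Sum>l\<in>{..<t} - {i, j} - {c}. y l) \<le> int (card ({..<t} - {i, j} - {c})) * s"
      using excess_le by (intro sum_bounded_above) auto
    moreover have "int (card ({..<t} - {i, j} - {c})) = int t - 3"
      using sum_y_pair(2)[OF X0(2-4)] c t3 by (simp add: card_Diff_singleton_if of_nat_diff)
    ultimately have "(int t - 2) * s \<le> y c + (int t - 3) * s" using rest by simp
    then show ?thesis using excess_le[OF c(1)] by (simp add: algebra_simps)
  qed
  \<comment> \<open>If column \<open>l\<close> shares the row, zero slack forces
    \<open>y c + y l \<ge> n\<close>. The two entries are at least \<open>y c = s\<close> and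
    \<open>y l\<close>, and together at most \<open>n\<close>, so both bounds are attained.\<close>
  have entry: "x X c = s \<or> x X c = n" if X: "X \<in> P" "0 < x X c" for X
  proof (cases "\<exists>l<t. l \<noteq> c \<and> 0 < x X l")
    case True
    then obtain l where l: "l < t" "l \<noteq> c" "0 < x X l" by blast
    have "n + (int t - 2) * s \<le> y c + y l + (int t - 2) * s"
      using sum sum_y_pair_le[of c l] c l by simp
    then show ?thesis using shared_row[of X c l] X c l yc by simp
  next
    case False
    then show ?thesis using unshared_entry[of X c] X c by blast
  qed
  define A where "A = {X \<in> P. 0 < x X c}"
  define \<beta> where "\<beta> = int (card {X \<in> A. x X c = n})"
  have finA: "finite A" unfolding A_def using finP by simp
  have "w c = (\<Sum>X\<in>A. s + (if x X c = n then n - s else 0))"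
    unfolding w_support A_def using entry by (intro sum.cong) auto
  also have "\<dots> = k c * s + \<beta> * (n - s)"
    using finA by (simp add: sum.distrib sum.If_cases \<beta>_def k_def A_def Int_def)
  finally have wc: "D + s = k c * s + \<beta> * (n - s)" using yc by (simp add: y_def)
  define T where "T = D mod M"
  have D: "D = M * s + T" unfolding T_def s_def by simp
  have T: "0 \<le> T" "T < M" unfolding T_def using M_pos by auto
  have eq: "int (card P) * n - n = int t * (M * s + T) + (int t - 2) * s" using slack D by simp
  have ge: "M * int t * n \<le> int (card P) * n - n" using rows_ge by (simp add: algebra_simps)
  \<comment> \<open>For \<open>n - s = 1\<close> the divisibility is trivial. For
    \<open>n - s \<ge> 2\<close> there is enough room to show that column \<open>c\<close> has
    exactly \<open>M + 1\<close> positive entries.\<close>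
  show ?thesis
  proof (cases "n - s = 1")
    case False
    then have \<delta>: "2 \<le> n - s" using s_less by simp
    have "M < k c"
    proof (rule ccontr)
      assume "\<not> ?thesis"
      then have "k c * n \<le> M * n" using n_pos by simp
      then have "D + s \<le> M * n" using w_le[OF c(1)] yc by (simp add: y_def)
      then have "int t * (D + s) \<le> int t * (M * n)" by (intro mult_left_mono) auto
      then show False using slack ge s_pos by (simp add: algebra_simps)
    qed
    \<comment> \<open>This excludes \<open>M + 2\<close> positive entries: they would need a total
      of at least \<open>(M + 2) * s\<close>, while the column holds
      \<open>(M + 1) * s + T\<close>.\<close>
    have "T < s"
    proof (rule ccontr)
      assume "\<not> ?thesis"
      then have sT: "s \<le> T" by simp
      have "M * int t * n = M * int t * s + M * int t * (n - s)" by (simp add: algebra_simps)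
      then have "M * int t * (n - s) \<le> int t * T + (int t - 2) * s"
        using ge eq by (simp add: algebra_simps)
      also have "\<dots> \<le> int t * T + (int t - 2) * T" using sT t3 by simp
      also have "\<dots> \<le> (2 * int t) * T" using T by (simp add: algebra_simps)
      also have "\<dots> < (2 * int t) * M" using T t3 by simp
      also have "\<dots> = M * int t * 2" by simp
      also have "\<dots> \<le> M * int t * (n - s)" using \<delta> M_pos by (intro mult_left_mono) auto
      finally show False by simp
    qed
    have "k c \<le> M + 1"
    proof (rule ccontr)
      assume "\<not> ?thesis"
      then have "(M + 2) * s \<le> k c * s" using s_pos by simp
      moreover have "0 \<le> \<beta> * (n - s)" using \<delta> by (simp add: \<beta>_def)
      ultimately show False using wc D \<open>T < s\<close> by (simp add: algebra_simps)
    qed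
    then have "k c = M + 1" using \<open>M < k c\<close> by simp
    then have "T = \<beta> * (n - s)" using wc D by (simp add: algebra_simps)
    then show ?thesis by (simp add: T_def)
  qed simp
qed

end

section \<open>Upper bound\<close>

lemma coloured_degree_le:
  assumes G: "simple_graph V E" and X: "X \<subseteq> V" "indep X E"
    and c: "\<And>u v. {u, v} \<in> E \<Longrightarrow> c u \<noteq> c v" and v: "v \<in> X"
  shows "degree V E v + card X + card {u \<in> V. c u = c v} \<le> card V + card {u \<in> X. c u = c v}"
proof -
  let ?W = "{u \<in> V. c u = c v}"
  have fin: "finite V" using G by (simp add: simple_graph_def)
  have finX: "finite X" using fin X finite_subset by blast
  have "v \<noteq> u" if "{v, u} \<in> E" for u using simple_graph_edge_neq[OF G that] .
  then have "{u \<in> V. {v, u} \<in> E} \<subseteq> V - (X \<union> ?W)"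
    using c[of v] X v unfolding indep_def by force
  then have "degree V E v \<le> card (V - (X \<union> ?W))"
    unfolding degree_def using fin by (intro card_mono) auto
  also have "\<dots> = card V - card (X \<union> ?W)"
    using fin X by (intro card_Diff_subset) (auto intro: finite_subset)
  finally have "degree V E v + card (X \<union> ?W) \<le> card V"
    using card_mono[OF fin, of "X \<union> ?W"] X by auto
  moreover have "card X + card ?W = card (X \<union> ?W) + card (X \<inter> ?W)"
    using finX fin by (intro card_Un_Int) auto
  moreover have "X \<inter> ?W = {u \<in> X. c u = c v}" using X by auto
  ultimately show ?thesis by simp
qed

lemma balanced_multipartite_card:
  assumes "balanced_multipartite n r V E"
  shows "card V = r * n"
proof -
  obtain P where P: "partition_on V P" "card P = r" "\<forall>X\<in>P. card X = n"
    and V: "finite V"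
    using assms unfolding balanced_multipartite_def simple_graph_def by blast
  have "finite X" if "X \<in> P" for X
    using P(1) V that partition_onD1 by (metis Union_upper finite_subset)
  then have "card V = (\<Sum>X\<in>P. card X)" by (rule product_partition[OF P(1)])
  then show ?thesis using P by simp
qed

text \<open>A positive entry supplies a vertex of that part and colour, and its degree bound is
  exactly the deficit condition of the matrix. \<open>D\<close> stays a parameter because the upper
  bound needs both \<open>d\<close> and \<open>d - 1\<close>.\<close>

lemma coloured_balanced_multipartite_slack:
  fixes M D :: int
  assumes B: "balanced_multipartite n r V E" and "0 < n"
    and c: "\<And>u. u \<in> V \<Longrightarrow> c u < t" "\<And>u v. {u, v} \<in> E \<Longrightarrow> c u \<noteq> c v"
    and deg: "\<And>u. u \<in> V \<Longrightarrow> (int r - 1) * int n - D \<le> int (degree V E u)"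
    and D: "0 \<le> D" "D < M * int n" and M: "0 < M" "M * int t < int r"
    and H: "H = int n + int t * D + (int t - 2) * (D div M) - int r * int n"
  shows "0 \<le> H" and "H = 0 \<Longrightarrow> 3 \<le> t \<Longrightarrow> (int n - D div M) dvd D mod M"
proof -
  obtain P where P: "partition_on V P" "card P = r" "\<And>X. X \<in> P \<Longrightarrow> card X = n \<and> indep X E"
    and G: "simple_graph V E"
    using B unfolding balanced_multipartite_def by blast
  have fin: "finite V" using G by (simp add: simple_graph_def)
  have finP: "finite P" using P(1) fin by (rule finite_elements[rotated])
  have sub: "X \<subseteq> V" if "X \<in> P" for X using P(1) that unfolding partition_on_def by blast
  have finX: "finite X" if "X \<in> P" for X using sub[OF that] fin finite_subset by blast
  define x where "x X j = int (card {u \<in> X. c u = j})" for X j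
  have col: "(\<Sum>X\<in>P. x X j) = int (card {u \<in> V. c u = j})" for j
  proof -
    have "{u \<in> V. c u = j} = (\<Union>X\<in>P. {u \<in> X. c u = j})"
      using P(1) unfolding partition_on_def by blast
    also have "card \<dots> = (\<Sum>X\<in>P. card {u \<in> X. c u = j})"
      using finP finX P(1) unfolding partition_on_def disjoint_def
      by (intro card_UN_disjoint) auto
    finally show ?thesis unfolding x_def by simp
  qed
  interpret sparse_column_matrix P x t "int n" M D
  proof
    show "finite P" by (rule finP)
    show "0 \<le> x X j" for X j by (simp add: x_def)
    show "0 < int n" "0 < M" "0 \<le> D" "D < M * int n" "M * int t < int (card P)"
      using assms P by auto
    show "(\<Sum>j<t. x X j) = int n" if "X \<in> P" for X
    proof -
      have "card X = (\<Sum>j<t. card {u \<in> X. c u = j})"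
        unfolding card_eq_sum using finX[OF that] c(1) sub[OF that]
        by (intro sum.group[symmetric]) auto
      then show ?thesis using P(3)[OF that] unfolding x_def by simp
    qed
    show "(\<Sum>Y\<in>P. x Y j) - x X j \<le> D" if X: "X \<in> P" "j < t" "0 < x X j" for X j
    proof -
      from X obtain v where v: "v \<in> X" "c v = j"
        unfolding x_def by (auto simp: card_gt_0_iff)
      have "degree V E v + n + card {u \<in> V. c u = j} \<le> r * n + card {u \<in> X. c u = j}"
        using coloured_degree_le[where c = c, OF G sub[OF X(1)] _ c(2) v(1)] P(3)[OF X(1)] v(2)
          balanced_multipartite_card[OF B] by simp
      then have "int (degree V E v) + int n + int (card {u \<in> V. c u = j})
          \<le> int r * int n + int (card {u \<in> X. c u = j})"
        by (metis (mono_tags) of_nat_add of_nat_le_iff of_nat_mult)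
      moreover have "(int r - 1) * int n - D \<le> int (degree V E v)"
        using deg v sub[OF X(1)] by blast
      ultimately show ?thesis unfolding col unfolding x_def by (simp add: algebra_simps)
    qed
  qed
  show "0 \<le> H" using slack_nonneg P(2) unfolding s_def H by simp
  show "(int n - D div M) dvd D mod M" if "H = 0" "3 \<le> t"
    using slack_zero_dvd that P(2) unfolding s_def H by simp
qed

section \<open>Construction\<close>

text \<open>The densest graph on \<open>V\<close> in which the fibres of \<open>p\<close> and those
  of \<open>c\<close> are independent, so that degrees depend on class sizes alone.\<close>

definition doubly_multipartite :: "'a set \<Rightarrow> ('a \<Rightarrow> 'b) \<Rightarrow> ('a \<Rightarrow> 'c) \<Rightarrow> 'a set set" where
  "doubly_multipartite V p c = {{u, v} | u v. u \<in> V \<and> v \<in> V \<and> p u \<noteq> p v \<and> c u \<noteq> c v}"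

lemma in_doubly_multipartite:
  "{u, v} \<in> doubly_multipartite V p c \<longleftrightarrow> u \<in> V \<and> v \<in> V \<and> p u \<noteq> p v \<and> c u \<noteq> c v"
  unfolding doubly_multipartite_def by (auto simp: doubleton_eq_iff)

lemma simple_graph_doubly_multipartite:
  "finite V \<Longrightarrow> simple_graph V (doubly_multipartite V p c)"
  unfolding simple_graph_def doubly_multipartite_def by auto

lemma degree_doubly_multipartite:
  assumes "finite V" "v \<in> V"
  shows "degree V (doubly_multipartite V p c) v + card {u \<in> V. p u = p v} + card {u \<in> V. c u = c v}
    = card V + card {u \<in> V. p u = p v \<and> c u = c v}"
proof -
  let ?X = "{u \<in> V. p u = p v}" and ?W = "{u \<in> V. c u = c v}"
  have "degree V (doubly_multipartite V p c) v = card (V - (?X \<union> ?W))"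
    unfolding degree_def in_doubly_multipartite using assms(2)
    by (intro arg_cong[where f = card]) auto
  also have "\<dots> = card V - card (?X \<union> ?W)"
    using assms by (intro card_Diff_subset) auto
  finally have "degree V (doubly_multipartite V p c) v + card (?X \<union> ?W) = card V"
    using card_mono[OF assms(1), of "?X \<union> ?W"] by auto
  moreover have "card ?X + card ?W = card (?X \<union> ?W) + card (?X \<inter> ?W)"
    using assms by (intro card_Un_Int) auto
  moreover have "?X \<inter> ?W = {u \<in> V. p u = p v \<and> c u = c v}" by auto
  ultimately show ?thesis by simp
qed

lemma doubly_multipartite_no_clique:
  assumes "\<And>v. v \<in> V \<Longrightarrow> c v < (t::nat)"
  shows "\<not> contains_complete (t + 1) V (doubly_multipartite V p c)"
proof
  assume "contains_complete (t + 1) V (doubly_multipartite V p c)"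
  then obtain S where S: "S \<subseteq> V" "card S = t + 1" "clique S (doubly_multipartite V p c)"
    unfolding contains_complete_def by blast
  then have "inj_on c S"
    unfolding inj_on_def clique_def in_doubly_multipartite by blast
  moreover have "c ` S \<subseteq> {..<t}" using S assms by auto
  ultimately have "card S \<le> card {..<t}" by (intro card_inj_on_le) auto
  then show False using S by simp
qed

text \<open>Vertices are numbers below \<open>r * n\<close>, read as the pair of their part
  \<open>v div n\<close> and their position \<open>v mod n\<close> in it. Class sizes thereby become
  sums over the parts.\<close>

lemma card_div_mod:
  fixes n r :: nat
  assumes "0 < n"
  shows "card {v \<in> {..<r * n}. Q (v div n) (v mod n)} = (\<Sum>i<r. card {b \<in> {..<n}. Q i b})"
proof -
  let ?S = "Sigma {..<r} (\<lambda>i. {b \<in> {..<n}. Q i b})"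
  have "bij_betw (\<lambda>(i, b). i * n + b) ?S {v \<in> {..<r * n}. Q (v div n) (v mod n)}"
  proof (rule bij_betw_byWitness[where f' = "\<lambda>v. (v div n, v mod n)"])
    show "(\<lambda>(i, b). i * n + b) ` ?S \<subseteq> {v \<in> {..<r * n}. Q (v div n) (v mod n)}"
    proof clarsimp
      fix i b assume *: "i < r" "b < n"
      then have "i * n + b < Suc i * n" by simp
      also have "\<dots> \<le> r * n" using * by (intro mult_le_mono1) simp
      finally show "i * n + b < r * n" .
    qed
  qed (use assms in \<open>auto simp: less_mult_imp_div_less\<close>)
  from bij_betw_same_card[OF this] show ?thesis by (subst (asm) card_SigmaI) auto
qed

lemma balanced_doubly_multipartite:
  assumes n: "0 < n"
  shows "balanced_multipartite n r {..<r * n} (doubly_multipartite {..<r * n} (\<lambda>v. v div n) c)"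
proof -
  let ?X = "\<lambda>i. {v \<in> {..<r * n}. v div n = i}"
  have card: "card (?X i) = n" if "i < r" for i
  proof -
    have "card (?X i) = (\<Sum>i'<r. card {b \<in> {..<n}. i' = i})"
      using card_div_mod[OF n, of r "\<lambda>i' b. i' = i"] by simp
    also have "\<dots> = (\<Sum>i'<r. if i' = i then n else 0)" by (rule sum.cong) auto
    finally show ?thesis using that by simp
  qed
  have "partition_on {..<r * n} (?X ` {..<r})"
  proof (rule partition_onI)
    show "\<Union> (?X ` {..<r}) = {..<r * n}" by (auto simp: less_mult_imp_div_less)
    show "{} \<notin> ?X ` {..<r}"
    proof
      assume "{} \<in> ?X ` {..<r}"
      then obtain i where "i < r" "?X i = {}" by blast
      then show False using card[of i] n by (metis card.empty less_irrefl)
    qed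
    show "disjnt A B" if "A \<in> ?X ` {..<r}" "B \<in> ?X ` {..<r}" "A \<noteq> B" for A B
      using that by (auto simp: disjnt_def)
  qed
  moreover have "inj_on ?X {..<r}"
  proof (rule inj_onI)
    fix i j assume *: "i \<in> {..<r}" "j \<in> {..<r}" "?X i = ?X j"
    then obtain v where "v \<in> ?X i" using card[of i] n by (metis card.empty ex_in_conv lessThan_iff less_irrefl)
    then show "i = j" using * by blast
  qed
  then have "card (?X ` {..<r}) = r" by (simp add: card_image)
  moreover have "indep (?X i) (doubly_multipartite {..<r * n} (\<lambda>v. v div n) c)" for i
    unfolding indep_def in_doubly_multipartite by simp
  ultimately show ?thesis
    unfolding balanced_multipartite_def using card simple_graph_doubly_multipartite[of "{..<r * n}"]
    by (intro conjI exI[of _ "?X ` {..<r}"]) auto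
qed

text \<open>
  Colour \<open>j < t - 1\<close> occupies \<open>\<zeta> l\<close> vertices of the part \<open>j * m + l\<close>, for \<open>l < m\<close>; all other vertices
  get colour \<open>t - 1\<close>, in particular the last \<open>m - a\<close> parts entirely. A vertex of colour \<open>t - 1\<close> in a
  part with \<open>\<zeta> l < n\<close> has large enough degree iff \<open>\<zeta> l \<le> s + H\<close>.
\<close>
lemma multipartite_construction:
  fixes n m t a r :: nat and D s H :: int and \<zeta> :: "nat \<Rightarrow> nat"
  assumes n: "0 < n" and m: "0 < m" and t: "0 < t" and a: "a \<le> m" and r: "r = m * t - a"
    and s: "0 \<le> s" and H: "H = int n + int t * D + (int t - 2) * s - int r * int n" "0 \<le> H"
    and \<zeta>: "\<And>l. l < m \<Longrightarrow> \<zeta> l \<le> n" "\<And>l. l < m \<Longrightarrow> s \<le> int (\<zeta> l)" "int (\<Sum>l<m. \<zeta> l) = D + s"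
      "\<And>l. l < m \<Longrightarrow> \<zeta> l = n \<or> int (\<zeta> l) \<le> s + H"
  shows "\<exists>(V :: nat set) E. balanced_multipartite n r V E \<and> \<not> contains_complete (t + 1) V E \<and>
    (\<forall>v\<in>V. (int r - 1) * int n - D \<le> int (degree V E v))"
proof -
  obtain q where q: "t = Suc q" using t by (cases t) auto
  have mq: "m * q \<le> r" using r q a by simp
  define col where "col i b = (if i < m * q \<and> b < \<zeta> (i mod m) then i div m else q)" for i b
  define c where "c v = col (v div n) (v mod n)" for v
  define V where "V = {..<r * n}"
  define E where "E = doubly_multipartite V (\<lambda>v. v div n) c"
  have divq: "i < m * q \<longleftrightarrow> i div m < q" for i
    using m by (simp add: div_less_iff_less_mult mult.commute)
  have col_less: "col i b = j \<longleftrightarrow> i div m = j \<and> b < \<zeta> (i mod m)" if "j < q" for i b j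
    using that unfolding col_def divq by auto
  have ct: "c v < t" for v unfolding c_def col_def divq q by auto
  have X: "card {u \<in> V. u div n = i} = n" if "i < r" for i
  proof -
    have "card {u \<in> V. u div n = i} = (\<Sum>i'<r. card {b \<in> {..<n}. i' = i})"
      unfolding V_def using card_div_mod[OF n, of r "\<lambda>i' b. i' = i"] by simp
    also have "\<dots> = (\<Sum>i'<r. if i' = i then n else 0)" by (rule sum.cong) auto
    finally show ?thesis using that by simp
  qed
  have XW: "card {u \<in> V. u div n = i \<and> c u = j} = card {b \<in> {..<n}. col i b = j}" if "i < r" for i j
  proof -
    have "card {u \<in> V. u div n = i \<and> c u = j} = (\<Sum>i'<r. card {b \<in> {..<n}. i' = i \<and> col i' b = j})"
      unfolding V_def c_def using card_div_mod[OF n, of r "\<lambda>i' b. i' = i \<and> col i' b = j"] by simp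
    also have "\<dots> = (\<Sum>i'<r. if i' = i then card {b \<in> {..<n}. col i b = j} else 0)"
      by (rule sum.cong) auto
    finally show ?thesis using that by simp
  qed
  have W: "int (card {u \<in> V. c u = j}) = D + s" if j: "j < q" for j
  proof -
    have "card {u \<in> V. c u = j} = (\<Sum>i<r. card {b \<in> {..<n}. col i b = j})"
      unfolding V_def c_def by (rule card_div_mod[OF n])
    also have "\<dots> = (\<Sum>i<r. if i div m = j then \<zeta> (i mod m) else 0)"
    proof (rule sum.cong)
      fix i
      have "{b. b < n \<and> b < \<zeta> (i mod m)} = {..<\<zeta> (i mod m)}" using \<zeta>(1)[of "i mod m"] m by auto
      then show "card {b \<in> {..<n}. col i b = j} = (if i div m = j then \<zeta> (i mod m) else 0)"
        using j by (simp add: col_less)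
    qed simp
    also have "\<dots> = (\<Sum>i\<in>{i \<in> {..<r}. i div m = j}. \<zeta> (i mod m))"
      by (rule sum.inter_filter[symmetric]) simp
    also have "\<dots> = (\<Sum>l<m. \<zeta> l)"
    proof (rule sum.reindex_bij_witness[where i = "\<lambda>l. j * m + l" and j = "\<lambda>i. i mod m"])
      fix l assume l: "l \<in> {..<m}"
      have "j * m + l < Suc j * m" using l by simp
      also have "\<dots> \<le> q * m" using j by (intro mult_le_mono1) simp
      finally show "j * m + l \<in> {i \<in> {..<r}. i div m = j}" using l mq by (simp add: mult.commute)
    qed (use m in auto)
    finally show ?thesis using \<zeta>(3) by simp
  qed
  \<comment> \<open>The last class gets what the other \<open>t - 1\<close> classes, of size
    \<open>D + s\<close> each, leave of the \<open>r * n\<close> vertices; the definition of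
    \<open>H\<close> turns this into the stated form.\<close>
  have Wq: "int (card {u \<in> V. c u = q}) = n + D - s - H"
  proof -
    have "card V = (\<Sum>j<t. card {u \<in> V. c u = j})"
      unfolding card_eq_sum using ct by (intro sum.group[symmetric]) (auto simp: V_def)
    also have "card V = r * n" by (simp add: V_def)
    finally have "int (r * n) = int (\<Sum>j<t. card {u \<in> V. c u = j})" by (rule arg_cong)
    then have "int (r * n) = (\<Sum>j<q. int (card {u \<in> V. c u = j})) + int (card {u \<in> V. c u = q})"
      by (simp only: q of_nat_add of_nat_sum sum.lessThan_Suc)
    also have "(\<Sum>j<q. int (card {u \<in> V. c u = j})) = int q * (D + s)" using W by simp
    finally show ?thesis using H(1) q by (simp add: algebra_simps)
  qed
  have "(int r - 1) * int n - D \<le> int (degree V E v)" if v: "v \<in> V" for v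
  proof -
    define i where "i = v div n"
    have i: "i < r" using v unfolding i_def V_def by (simp add: less_mult_imp_div_less)
    have "degree V E v + card {u \<in> V. u div n = i} + card {u \<in> V. c u = c v}
        = card V + card {u \<in> V. u div n = i \<and> c u = c v}"
      unfolding E_def i_def by (rule degree_doubly_multipartite) (use v V_def in auto)
    then have "degree V E v + n + card {u \<in> V. c u = c v}
        = r * n + card {b \<in> {..<n}. col i b = c v}"
      unfolding X[OF i] XW[OF i] by (simp add: V_def)
    then have "int (degree V E v + n + card {u \<in> V. c u = c v})
        = int (r * n + card {b \<in> {..<n}. col i b = c v})" by (rule arg_cong)
    then have "int (degree V E v) + int n + int (card {u \<in> V. c u = c v})
        = int r * int n + int (card {b \<in> {..<n}. col i b = c v})"
      by (simp only: of_nat_add of_nat_mult)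
    moreover have "int (card {u \<in> V. c u = c v}) - int (card {b \<in> {..<n}. col i b = c v}) \<le> D"
    proof (cases "c v < q")
      case True
      have "i div m = c v" using col_less[OF True, of i "v mod n"] unfolding c_def i_def by simp
      moreover have "{b. b < n \<and> b < \<zeta> (i mod m)} = {..<\<zeta> (i mod m)}"
        using \<zeta>(1)[of "i mod m"] m by auto
      ultimately have "card {b \<in> {..<n}. col i b = c v} = \<zeta> (i mod m)"
        by (simp add: col_less[OF True])
      then show ?thesis using W[OF True] \<zeta>(2)[of "i mod m"] m by simp
    next
      case False
      then have cv: "c v = q" using ct[of v] q by simp
      show ?thesis
      proof (cases "i < m * q")
        case True
        have iq: "i div m < q" using True divq by simp
        have "{b \<in> {..<n}. col i b = q} = {\<zeta> (i mod m)..<n}"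
          using True iq unfolding col_def by auto
        then have "card {b \<in> {..<n}. col i b = q} = n - \<zeta> (i mod m)" by simp
        \<comment> \<open>The vertex \<open>v\<close> itself shows that its part is not filled by an
          earlier colour, which leaves the second alternative of the last condition on
          \<zeta>.\<close>
        moreover have "\<zeta> (i mod m) \<le> v mod n"
          using cv True iq unfolding c_def col_def i_def by (auto split: if_splits)
        then have "\<zeta> (i mod m) < n" using n by (meson le_less_trans mod_less_divisor)
        moreover from this have "int (\<zeta> (i mod m)) \<le> s + H" using \<zeta>(4)[of "i mod m"] m by auto
        ultimately show ?thesis using Wq unfolding cv by simp
      next
        case False
        then have "{b \<in> {..<n}. col i b = q} = {..<n}" unfolding col_def by auto
        then show ?thesis using Wq H(2) s unfolding cv by simp
      qed
    qed
    ultimately show ?thesis by (simp add: algebra_simps)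
  qed
  moreover have "balanced_multipartite n r V E"
    unfolding E_def V_def by (rule balanced_doubly_multipartite[OF n])
  moreover have "\<not> contains_complete (t + 1) V E"
    unfolding E_def using ct by (rule doubly_multipartite_no_clique)
  ultimately show ?thesis by blast
qed

text \<open>Each colour but the last has total \<open>D + s = m * s + T\<close>, so \<open>T\<close>
  is to be spread over \<open>m\<close> entries on top of \<open>s\<close>. If \<open>H > 0\<close>,
  raising \<open>T\<close> of them by 1 is allowed; if \<open>H = 0\<close>, an entry may only stay
  at \<open>s\<close> or jump to \<open>n\<close>, and divisibility makes such jumps add up to
  \<open>T\<close>.\<close>

lemma multipartite_construction_slack:
  fixes n m t a r :: nat and D H :: int
  assumes n: "0 < n" and m: "2 \<le> m" and t: "0 < t" and a: "a \<le> m" and r: "r = m * t - a"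
    and D: "0 \<le> D" "D \<le> (int m - 1) * int n"
    and H: "H = int n + int t * D + (int t - 2) * (D div (int m - 1)) - int r * int n"
    and feasible: "0 < H \<or> H = 0 \<and> (int n - D div (int m - 1)) dvd D mod (int m - 1)"
  shows "\<exists>(V :: nat set) E. balanced_multipartite n r V E \<and> \<not> contains_complete (t + 1) V E \<and>
    (\<forall>v\<in>V. (int r - 1) * int n - D \<le> int (degree V E v))"
proof -
  define M where "M = int m - 1"
  define s T where "s = nat (D div M)" and "T = nat (D mod M)"
  have M: "0 < M" using m by (simp add: M_def)
  have s: "int s = D div M" unfolding s_def using D M by (simp add: pos_imp_zdiv_nonneg_iff)
  have T: "int T = D mod M" unfolding T_def using M by simp
  have DM: "D = M * int s + int T" using s T by simp
  have TM: "int T < M" using T M by simp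
  have sn: "s \<le> n"
  proof -
    have "M * int s \<le> M * int n" using DM D unfolding M_def[symmetric] by simp
    then show ?thesis using M by simp
  qed
  have sum_extra: "int (\<Sum>l<m. s + (if l < b then e else 0)) = D + int s"
    if "b * e = T" "b \<le> m" for b e
  proof -
    have "(\<Sum>l<m. if l < b then e else 0) = (\<Sum>l\<in>{l \<in> {..<m}. l < b}. e)"
      by (rule sum.inter_filter[symmetric]) simp
    also have "{l \<in> {..<m}. l < b} = {..<b}" using that by auto
    finally have "(\<Sum>l<m. s + (if l < b then e else 0)) = m * s + T"
      using that by (simp add: sum.distrib)
    then show ?thesis using DM by (simp add: M_def algebra_simps)
  qed
  note con = multipartite_construction[OF n _ t a r _ H[folded M_def, folded s]]
  show ?thesis
  proof (cases "0 < H")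
    case True
    have sT: "s + 1 \<le> n" if "0 < T"
    proof -
      have "M * int s < M * int n" using DM D that unfolding M_def[symmetric] by simp
      then show ?thesis using M by simp
    qed
    have "int (\<Sum>l<m. s + (if l < T then 1 else 0)) = D + int s"
      by (rule sum_extra) (use TM in \<open>auto simp: M_def\<close>)
    then show ?thesis
      by (intro con[of "\<lambda>l. s + (if l < T then 1 else 0)"]) (use True m sn sT in auto)
  next
    case False
    then have H0: "H = 0" and "(int n - int s) dvd int T"
      using feasible s T unfolding M_def by auto
    then have "int (n - s) dvd int T" using sn by (simp add: of_nat_diff)
    then have dvd: "(n - s) dvd T" by simp
    \<comment> \<open>If \<open>s = n\<close> the divisor is 0; then \<open>T = 0\<close> by
      divisibility, and division by 0 gives the right value \<open>b = 0\<close>.\<close>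
    define b where "b = T div (n - s)"
    have b: "b * (n - s) = T" using dvd by (simp add: b_def)
    have "b \<le> T" unfolding b_def by simp
    then have bm: "b \<le> m" using TM by (simp add: M_def)
    show ?thesis
      by (intro con[of "\<lambda>l. s + (if l < b then n - s else 0)"]) (use H0 m sn sum_extra[OF b bm] in auto)
  qed
qed

section \<open>The extremal minimum degree\<close>

theorem corollary4p1:
  fixes n m t a r :: nat and d s T H \<epsilon> :: int
  assumes "n > 0" and "r > 0" and "m \<ge> 2" and "t \<ge> 3"
    and "2 \<le> a" and "a \<le> min m (t - 1)" and "r = m * t - a"
    and "d = \<lceil>(real m - 1) * (real r - 1) * real n / (real m * real t - 2)\<rceil>"
    and "s = \<lfloor>real_of_int d / (real m - 1)\<rfloor>"
    and "T = d - (int m - 1) * s"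
    and "H = int n + int t * d + (int t - 2) * s - int r * int n"
    and "\<epsilon> = (if H < 0 \<or> (H = 0 \<and> \<not> (int n - s) dvd T) then 1 else 0)"
    and "(int r - 1) * int n - d - \<epsilon>
           \<ge> \<lfloor>(3 * real t - 4) / (3 * real t - 1) * real r * real n\<rfloor>"
  shows "int (max_min_degree n r (t + 1)) = (int r - 1) * int n - d - \<epsilon>"
proof -
  note n = assms(1) and m = assms(3) and t = assms(4)
  define M where "M = int m - 1"
  have M: "0 < M" using m by (simp add: M_def)
  have am: "a \<le> m" and at: "a < t" using assms(4,6) by auto
  have "m \<le> m * t" using t by simp
  then have mt: "a \<le> m * t" using am by linarith
  have r: "int r = (M + 1) * int t - int a"
    using assms(7) mt by (simp add: M_def of_nat_diff)
  define K where "K = (M + 1) * int t - 2"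
  have "1 * 3 \<le> M * int t" using M t by (intro mult_mono) auto
  then have K: "0 < K" using t by (simp add: K_def algebra_simps)
  have rK: "int r - 1 < K" using r assms(5) by (simp add: K_def)
  have Mt: "M * int t < int r" using r at by (simp add: algebra_simps)
  have r1: "0 < int r - 1" using Mt \<open>1 * 3 \<le> M * int t\<close> by simp
  define R where "R = M * (int r - 1) * int n"
  have R: "0 < R" unfolding R_def using M r1 n by simp
  have "d = \<lceil>real_of_int R / real_of_int K\<rceil>"
    unfolding assms(8) R_def K_def M_def by simp
  then have "real_of_int R / real_of_int K \<le> real_of_int d" "real_of_int (d - 1) < real_of_int R / real_of_int K"
    by linarith+
  then have "real_of_int R \<le> real_of_int (d * K)" "real_of_int ((d - 1) * K) < real_of_int R"
    using K by (auto simp: field_simps)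
  then have dK: "R \<le> d * K" "(d - 1) * K < R" by linarith+
  have d_pos: "0 < d"
  proof (rule ccontr)
    assume "\<not> ?thesis"
    then have "d * K \<le> 0" using K by (simp add: mult_nonpos_nonneg)
    then show False using dK R by simp
  qed
  have "R \<le> K * (M * int n)"
    unfolding R_def using rK M by (simp add: mult.assoc mult.left_commute mult_right_mono)
  then have "(d - 1) * K < (M * int n) * K" using dK by (simp add: mult.commute)
  then have dM: "d - 1 < M * int n" using K by simp
  have s: "s = d div M"
    unfolding assms(9) M_def using floor_divide_of_int_eq[of d "int m - 1", where 'a = real] by simp
  have T: "T = d mod M" unfolding assms(10) s M_def[symmetric] by (simp add: minus_mult_div_eq_mod)
  have H: "H = int n + int t * d + (int t - 2) * (d div M) - int r * int n"
    using assms(11) s by simp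
  \<comment> \<open>This gives the upper bound its strict inequality on the deficit and the
    construction \<open>d + 1 \<le> M * n\<close>. At \<open>d = M * n\<close> the slack is
    \<open>(a - 1) * n\<close>, positive since \<open>a \<ge> 2\<close>, so no correction occurs
    there.\<close>
  have \<epsilon>1: "d < M * int n" if "\<epsilon> = 1"
  proof (rule ccontr)
    assume "\<not> ?thesis"
    then have "d = M * int n" using dM by simp
    then have "H = (int a - 1) * int n" using M unfolding H r by (simp add: algebra_simps)
    then have "0 < H" using assms(5) n by simp
    then show False using that assms(12) by simp
  qed
  define D where "D = d + \<epsilon>"
  have \<epsilon>: "\<epsilon> = 0 \<or> \<epsilon> = 1" using assms(12) by simp
  have D: "0 < D" "D \<le> M * int n" using d_pos dM \<epsilon>1 \<epsilon> unfolding D_def by auto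

  have upper: "int (min_degree V E) \<le> (int r - 1) * int n - D"
    if B: "balanced_multipartite n r V E" and free: "\<not> contains_complete (t + 1) V E"
    for V :: "nat set" and E
  proof (rule ccontr)
    assume big: "\<not> ?thesis"
    have G: "simple_graph V E" using B unfolding balanced_multipartite_def by blast
    then have fin: "finite V" by (simp add: simple_graph_def)
    have deg: "(int r - 1) * int n - (D - 1) \<le> int (degree V E u)" if "u \<in> V" for u
    proof -
      have "min_degree V E \<le> degree V E u" unfolding min_degree_def using fin that by simp
      then show ?thesis using big by simp
    qed
    \<comment> \<open>For cliques of size \<open>t + 1\<close> the theorem is used with
      \<open>t - 1\<close>, which gives the constants \<open>3t - 4\<close> and
      \<open>3t - 1\<close>. An integer above the floor of a real exceeds the real, so the floored
      hypothesis suffices.\<close>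
    have "\<exists>c. (\<forall>u\<in>V. c u < t - 1 + 1) \<and> (\<forall>u v. {u, v} \<in> E \<longrightarrow> c u \<noteq> c v)"
    proof (rule andrasfai_erdos_sos[OF G])
      show "\<not> contains_complete (t - 1 + 2) V E" using free t by simp
      fix u assume u: "u \<in> V"
      have "\<lfloor>(3 * real t - 4) / (3 * real t - 1) * real r * real n\<rfloor> < int (degree V E u)"
        using assms(13) deg[OF u] unfolding D_def by simp
      then have "(3 * real t - 4) / (3 * real t - 1) * real r * real n < real (degree V E u)"
        by linarith
      moreover have "0 < 3 * real t - 1" using t by simp
      ultimately have "(3 * real t - 4) * (real r * real n) < (3 * real t - 1) * real (degree V E u)"
        by (simp add: field_simps)
      then have "real_of_int ((3 * int t - 4) * int (card V)) < real_of_int ((3 * int t - 1) * int (degree V E u))"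
        by (simp add: balanced_multipartite_card[OF B])
      then have "(3 * int t - 4) * int (card V) < (3 * int t - 1) * int (degree V E u)"
        by linarith
      then show "(3 * int (t - 1) - 1) * int (card V) < (3 * int (t - 1) + 2) * int (degree V E u)"
        using t by (simp add: of_nat_diff)
    qed
    then obtain c where c: "\<And>u. u \<in> V \<Longrightarrow> c u < t" "\<And>u v. {u, v} \<in> E \<Longrightarrow> c u \<noteq> c v"
      using t by auto
    note slack = coloured_balanced_multipartite_slack[where c = c, OF B n c deg _ _ M Mt refl]
    show False
    proof (cases "\<epsilon> = 0")
      case False
      then have D1: "D - 1 = d" and e1: "\<epsilon> = 1" using \<epsilon> by (auto simp: D_def)
      have "0 \<le> H" "H = 0 \<Longrightarrow> (int n - s) dvd T"
        using slack[unfolded D1] d_pos \<epsilon>1[OF e1] t unfolding H s T by auto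
      then show False using assms(12) e1 by (auto split: if_splits)
    next
      case True
      then have D1: "D - 1 = d - 1" by (simp add: D_def)
      \<comment> \<open>Dropping the floor in the slack inequality at \<open>d - 1\<close> gives
        \<open>R \<le> (d - 1) * K\<close>, against the choice of \<open>d\<close> as a
        ceiling.\<close>
      let ?q = "(d - 1) div M"
      have "0 \<le> int n + int t * (d - 1) + (int t - 2) * ?q - int r * int n"
        by (rule slack(1)[unfolded D1]) (use d_pos dM in auto)
      then have "M * ((int r - 1) * int n) \<le> M * (int t * (d - 1) + (int t - 2) * ?q)"
        using M by (intro mult_left_mono) (auto simp: algebra_simps)
      also have "\<dots> = M * int t * (d - 1) + (int t - 2) * (M * ?q)" by (simp add: algebra_simps)
      also have "(int t - 2) * (M * ?q) \<le> (int t - 2) * (d - 1)"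
      proof (rule mult_left_mono)
        have "M * ?q + (d - 1) mod M = d - 1" by simp
        moreover have "0 \<le> (d - 1) mod M" using M by simp
        ultimately show "M * ?q \<le> d - 1" by linarith
      qed (use t in simp)
      finally have "R \<le> (d - 1) * K" by (simp add: R_def K_def algebra_simps)
      then show False using dK by simp
    qed
  qed

  define H' where "H' = int n + int t * D + (int t - 2) * (D div M) - int r * int n"
  have "0 < H' \<or> H' = 0 \<and> (int n - D div M) dvd D mod M"
  proof (cases "\<epsilon> = 0")
    case True
    then have "H' = H" "D = d" by (simp_all add: H'_def H D_def)
    then show ?thesis using True assms(12) unfolding s T by (auto split: if_splits)
  next
    case False
    then have D1: "D = d + 1" using \<epsilon> by (auto simp: D_def)
    \<comment> \<open>The floor loses at most \<open>M - 1\<close>. Going from \<open>d\<close> to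
      \<open>d + 1\<close> gains \<open>K\<close>, and
      \<open>K - (t - 2) * (M - 1) = 2t + 2M - 4\<close> is positive, so one correction step always
      suffices.\<close>
    have "D - (M - 1) \<le> M * (D div M)"
    proof -
      have "M * (D div M) + D mod M = D" by simp
      moreover have "D mod M < M" using M by simp
      ultimately show ?thesis by linarith
    qed
    then have "(int t - 2) * (D - (M - 1)) \<le> (int t - 2) * (M * (D div M))"
      using t by (intro mult_left_mono) auto
    moreover have "M * H' = M * int t * D + (int t - 2) * (M * (D div M)) - R"
      by (simp add: H'_def R_def algebra_simps)
    ultimately have "M * int t * D + (int t - 2) * (D - (M - 1)) - R \<le> M * H'" by simp
    moreover have "M * int t * D + (int t - 2) * (D - (M - 1)) = d * K + K - (int t - 2) * (M - 1)"
      unfolding K_def D1 by (simp add: algebra_simps)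
    moreover have "K - (int t - 2) * (M - 1) = 2 * int t + 2 * M - 4"
      by (simp add: K_def algebra_simps)
    ultimately have "0 < M * H'" using dK M t by simp
    then show ?thesis using M by (simp add: zero_less_mult_iff)
  qed
  then obtain V :: "nat set" and E where VE: "balanced_multipartite n r V E"
      "\<not> contains_complete (t + 1) V E"
    and deg: "\<And>v. v \<in> V \<Longrightarrow> (int r - 1) * int n - D \<le> int (degree V E v)"
    using multipartite_construction_slack[OF n m _ am assms(7), of D H'] D t
    unfolding H'_def M_def by auto
  have "card V \<noteq> 0" using balanced_multipartite_card[OF VE(1)] n assms(2) by simp
  then have "min_degree V E \<in> degree V E ` V"
    unfolding min_degree_def by (intro Min_in) (auto simp: card_gt_0_iff intro: card_ge_0_finite)
  then have min: "int (min_degree V E) = (int r - 1) * int n - D"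
    using upper[OF VE] deg by fastforce
  have "max_min_degree n r (t + 1) = min_degree V E"
    unfolding max_min_degree_def
  proof (rule Max_eqI)
    let ?A = "{min_degree V E | (V :: nat set) E.
      balanced_multipartite n r V E \<and> \<not> contains_complete (t + 1) V E}"
    show le: "y \<le> min_degree V E" if "y \<in> ?A" for y
      using that upper min by fastforce
    then show "finite ?A" by (meson finite_nat_set_iff_bounded_le)
    show "min_degree V E \<in> ?A" using VE by blast
  qed
  then show ?thesis using min by (simp add: D_def)
qed

end
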